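(* Let $q$ be a prime power and $n\ge 2$ an integer. The girth of the bipartite graph $G(n,q)$ is $8$.
   Context: $\mathbb{S}_n(\mathbb{F}_q)$ denotes the set of $n\times n$ symmetric matrices over $\mathbb{F}_q$ (its elements are called points). Two points $S,S'$ are adjacent if $\operatorname{rank}(S-S')=1$. A line is a maximal set of rank $1$: a subset $\mathcal{M}\subseteq\mathbb{S}_n(\mathbb{F}_q)$ such that any two distinct points of $\mathcal{M}$ are adjacent and no point of $\mathbb{S}_n(\mathbb{F}_q)\setminus\mathcal{M}$ is adjacent to every point of $\mathcal{M}$. $G(n,q)$ is the bipartite graph whose vertex set is the disjoint union of the set of points and the set of lines, with a point joined to a line if and only if the point belongs to the line. *)

theory Defs
  imports
    "HOL-Analysis.Analysis"
    "HOL-Number_Theory.Prime_Powers"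
    "Graph_Theory.Graph_Theory"
begin

definition symmetric_matrices :: "('a::field ^ 'n ^ 'n) set" where
  "symmetric_matrices = {S. transpose S = S}"

definition adjacent_points :: "'a::field ^ 'n ^ 'n \<Rightarrow> 'a ^ 'n ^ 'n \<Rightarrow> bool" where
  "adjacent_points S S' \<longleftrightarrow> rank (S - S') = 1"

definition symmetric_lines :: "('a::field ^ 'n ^ 'n) set set" where
  "symmetric_lines = {M. M \<subseteq> symmetric_matrices \<and>
     (\<forall>S\<in>M. \<forall>S'\<in>M. S \<noteq> S' \<longrightarrow> adjacent_points S S') \<and>
     \<not> (\<exists>T \<in> symmetric_matrices - M. \<forall>S\<in>M. adjacent_points T S)}"

text \<open>An undirected edge is encoded as a pair of opposite arcs.\<close>

definition symmetric_matrix_graph ::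
    "('a::field ^ 'n ^ 'n + ('a ^ 'n ^ 'n) set) pair_pre_digraph" where
  "symmetric_matrix_graph =
     \<lparr>pverts = symmetric_matrices <+> symmetric_lines,
      parcs = {(Inl S, Inr M) | S M. S \<in> symmetric_matrices \<and> M \<in> symmetric_lines \<and> S \<in> M}
            \<union> {(Inr M, Inl S) | S M. S \<in> symmetric_matrices \<and> M \<in> symmetric_lines \<and> S \<in> M}\<rparr>"

text \<open>In a symmetric digraph, going along an edge and back is a \<^const>\<open>pre_digraph.cycle\<close>
  of length 2, and a loop is one of length 1. The cycles of length at least 3 are exactly
  the (rooted, oriented) cycles of the underlying simple graph. A graph without such cycles has
  girth \<open>\<infinity>\<close>, as \<open>Inf {} = \<infinity>\<close> in \<^typ>\<open>enat\<close>.\<close>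

definition girth :: "'v pair_pre_digraph \<Rightarrow> enat" where
  "girth G = (INF p \<in> {p. pre_digraph.cycle (with_proj G) p \<and> 3 \<le> length p}. enat (length p))"

lemma pair_graph_symmetric_matrix_graph:
  "pair_graph (symmetric_matrix_graph :: ('a::{field,finite} ^ 'n ^ 'n + ('a ^ 'n ^ 'n) set) pair_pre_digraph)"
  by unfold_locales
     (auto simp: symmetric_matrix_graph_def symmetric_def intro!: symI)

end

theory Submission
  imports Defs
begin

text \<open>Symmetric matrices of rank 1 have the form \<open>c x x\<^sup>T\<close>, and a principal \<open>2 \<times> 2\<close> minor of
  \<open>c x x\<^sup>T - d y y\<^sup>T\<close> equals \<open>- c d (x\<^sub>i y\<^sub>j - x\<^sub>j y\<^sub>i)\<^sup>2\<close>. So three pairwise adjacent points lie on a common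
  affine line \<open>{A + k (B - A)}\<close>. The lines are therefore exactly the affine lines through two adjacent
  points, two points lie on at most one line, and there are no triangles, which excludes cycles of
  length 4 and 6. For \<open>a \<noteq> b\<close> the points
  \<open>0\<close>, \<open>E\<^sub>a\<^sub>a\<close>, \<open>E\<^sub>a\<^sub>a + E\<^sub>b\<^sub>b\<close>, \<open>E\<^sub>b\<^sub>b\<close> form a quadrangle, which gives a cycle of length 8.\<close>

section \<open>Rank-one matrices\<close>

text \<open>Rank 1 means that all rows are multiples of one nonzero row. Vanishing of all 2 x 2
  minors turns later rank claims into entrywise algebra.\<close>

lemma rank_eq_1_iff_minors:
  fixes A :: "'a::field ^ 'n ^ 'm"
  shows "rank A = 1 \<longleftrightarrow> A \<noteq> 0 \<and> (\<forall>i j k l. A$i$j * A$k$l = A$i$l * A$k$j)"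
proof
  assume r: "rank A = 1"
  then have d: "vec.dim (rows A) = 1"
    by (simp add: row_rank_def_gen)
  obtain B where B: "rows A \<subseteq> vec.span B" "card B = 1"
    using vec.basis_exists[of "rows A"] d by metis
  then obtain v where v: "rows A \<subseteq> vec.span {v}"
    by (metis card_1_singletonE)
  have "\<exists>k. A$i = k *s v" for i
  proof -
    have "A$i \<in> rows A"
      by (auto simp: rows_def row_def)
    then show ?thesis
      using v by (auto simp: vec.span_singleton)
  qed
  then obtain u where u: "\<And>i. A$i = u i *s v"
    by metis
  have "A \<noteq> 0"
  proof
    assume "A = 0"
    then have "rows A \<subseteq> {0}"
      by (auto simp: rows_def row_def vec_eq_iff)
    then show False
      using d by (metis vec.dim_le_card card.empty finite.emptyI le_zero_eq one_neq_zero
          vec.span_empty)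
  qed
  then show "A \<noteq> 0 \<and> (\<forall>i j k l. A$i$j * A$k$l = A$i$l * A$k$j)"
    by (simp add: u)
next
  assume A: "A \<noteq> 0 \<and> (\<forall>i j k l. A$i$j * A$k$l = A$i$l * A$k$j)"
  then obtain i j where ij: "A$i$j \<noteq> 0"
    by (auto simp: vec_eq_iff)
  have row_multiple: "A$k = (A$k$j / A$i$j) *s A$i" for k
  proof -
    have "A$k$l * A$i$j = A$k$j * A$i$l" for l
      using A by (metis mult.commute)
    then show ?thesis
      using ij by (simp add: vec_eq_iff field_simps)
  qed
  have "rows A \<subseteq> vec.span {A$i}"
  proof
    fix r assume "r \<in> rows A"
    then obtain k where "r = A$k"
      by (auto simp: rows_def row_def)
    then show "r \<in> vec.span {A$i}"
      using row_multiple[of k] by (metis vec.span_singleton rangeI)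
  qed
  moreover have "{A$i} \<subseteq> rows A"
    by (auto simp: rows_def row_def)
  moreover have "A$i \<noteq> 0"
    using ij by (auto simp: vec_eq_iff)
  ultimately have "vec.dim (rows A) = 1"
    using vec.dim_unique[of "{A$i}" "rows A" 1] by simp
  then show "rank A = 1"
    by (simp add: row_rank_def_gen)
qed

text \<open>Once a diagonal entry \<open>A$a$a\<close> is nonzero, the minor in rows
  \<open>i\<close>, \<open>a\<close> and columns \<open>j\<close>, \<open>a\<close> expresses
  \<open>A$i$j\<close> through row \<open>a\<close>. The scalar \<open>c\<close> stays because it
  need not be a square.\<close>

lemma symmetric_rank_1E:
  fixes A :: "'a::field ^ 'n ^ 'n"
  assumes "A \<in> symmetric_matrices" "rank A = 1"
  obtains c x a where "c \<noteq> 0" "x$a \<noteq> 0" "\<And>i j. A$i$j = c * x$i * x$j"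
proof -
  have minors: "A$i$j * A$k$l = A$i$l * A$k$j" for i j k l
    using assms(2) rank_eq_1_iff_minors by blast
  have sym: "A$i$j = A$j$i" for i j
  proof -
    have "transpose A $ i $ j = A$i$j"
      using assms(1) by (simp add: symmetric_matrices_def)
    then show ?thesis
      by (simp add: transpose_def)
  qed
  obtain a b where "A$a$b \<noteq> 0"
    using assms(2) rank_eq_1_iff_minors[of A] by (auto simp: vec_eq_iff)
  \<comment> \<open>By symmetry the principal minor on \<open>a\<close>, \<open>b\<close> reads
    \<open>A$a$a * A$b$b = (A$a$b)^2\<close>, and the right side is nonzero.\<close>
  then have aa: "A$a$a \<noteq> 0"
    using minors[of a a b b] sym[of a b] by auto
  show thesis
  proof (rule that[of "1 / A$a$a" "A$a" a])
    show "A$i$j = 1 / A$a$a * A$a$i * A$a$j" for i j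
      using minors[of i j a a] sym[of i a] aa by (simp add: field_simps)
  qed (use aa in auto)
qed

lemma symmetric_rank_1_diff_proportional:
  fixes D E :: "'a::field ^ 'n ^ 'n"
  assumes D: "D \<in> symmetric_matrices" "rank D = 1"
    and E: "E \<in> symmetric_matrices" "rank E = 1"
    and DE: "rank (D - E) = 1"
  obtains k where "\<And>i j. E$i$j = k * D$i$j"
proof -
  obtain c x a where x: "c \<noteq> 0" "x$a \<noteq> 0" "\<And>i j. D$i$j = c * x$i * x$j"
    using symmetric_rank_1E[OF D] by blast
  obtain d y b where y: "d \<noteq> 0" "y$b \<noteq> 0" "\<And>i j. E$i$j = d * y$i * y$j"
    using symmetric_rank_1E[OF E] by blast
  \<comment> \<open>The vanishing principal minor of \<open>D - E\<close> is a perfect square times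
    \<open>c * d\<close>, with no factor 2, so characteristic 2 needs no separate case.\<close>
  have cross: "x$i * y$j = x$j * y$i" for i j
  proof -
    have "(D - E)$i$i * (D - E)$j$j = (D - E)$i$j * (D - E)$j$i"
      using DE rank_eq_1_iff_minors by blast
    then have "c * d * (x$i * y$j - x$j * y$i)^2 = 0"
      by (simp add: x(3) y(3) power2_eq_square algebra_simps)
    then show ?thesis
      using x(1) y(1) by simp
  qed
  have yk: "y$i = y$a / x$a * x$i" for i
    using cross[of a i] x(2) by (simp add: field_simps)
  show thesis
  \<comment> \<open>Here \<open>y\<close> is \<open>y$a / x$a\<close> times \<open>x\<close>, and
    this ratio enters \<open>E\<close> quadratically.\<close>
  proof (rule that[of "d / c * (y$a / x$a)^2"])
    fix i j
    show "E$i$j = d / c * (y$a / x$a)^2 * D$i$j"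
      unfolding x(3) y(3) by (subst yk[of i], subst yk[of j])
        (use x in \<open>simp add: power2_eq_square field_simps\<close>)
  qed
qed

section \<open>Maximal sets of rank 1 as affine lines\<close>

definition affine_line :: "'a::field ^ 'n ^ 'n \<Rightarrow> 'a ^ 'n ^ 'n \<Rightarrow> ('a ^ 'n ^ 'n) set" where
  "affine_line A B = range (\<lambda>k. \<chi> i j. A$i$j + k * (B$i$j - A$i$j))"

lemma adjacent_points_sym:
  fixes A B :: "'a::field ^ 'b ^ 'b"
  shows "adjacent_points A B \<longleftrightarrow> adjacent_points B A"
proof -
  have "rank (- D) = 1 \<longleftrightarrow> rank D = 1" for D :: "'a ^ 'b ^ 'b"
    unfolding rank_eq_1_iff_minors by simp
  from this[of "B - A"] show ?thesis
    unfolding adjacent_points_def by (simp only: minus_diff_eq)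
qed

lemma symmetric_matrices_diff:
  "A \<in> symmetric_matrices \<Longrightarrow> B \<in> symmetric_matrices \<Longrightarrow> A - B \<in> symmetric_matrices"
  by (simp add: symmetric_matrices_def transpose_def vec_eq_iff)

text \<open>With \<open>A\<close> as origin, \<open>B - A\<close> and \<open>C - A\<close> are
  symmetric of rank 1 with a difference of rank 1, hence proportional.\<close>

lemma mem_affine_line_if_adjacent:
  assumes "A \<in> symmetric_matrices" "B \<in> symmetric_matrices" "C \<in> symmetric_matrices"
    and "adjacent_points A B" "adjacent_points C A" "adjacent_points C B"
  shows "C \<in> affine_line A B"
proof -
  have "rank (B - A - (C - A)) = 1"
    using assms(6) adjacent_points_sym by (auto simp: adjacent_points_def)
  then obtain k where "\<And>i j. (C - A)$i$j = k * (B - A)$i$j"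
    using symmetric_rank_1_diff_proportional[of "B - A" "C - A"] assms
    by (metis adjacent_points_def adjacent_points_sym symmetric_matrices_diff)
  then have "C = (\<chi> i j. A$i$j + k * (B$i$j - A$i$j))"
    by (simp add: vec_eq_iff algebra_simps)
  then show ?thesis
    by (auto simp: affine_line_def)
qed

text \<open>Differences of points on the line are multiples of \<open>A - B\<close>, and a scalar
  factor enters each 2 x 2 minor as its square.\<close>

lemma adjacent_points_affine_line:
  assumes AB: "adjacent_points A B" and ST: "S \<in> affine_line A B" "T \<in> affine_line A B" "S \<noteq> T"
  shows "adjacent_points S T"
proof -
  obtain s t where s: "S = (\<chi> i j. A$i$j + s * (B$i$j - A$i$j))"
    and t: "T = (\<chi> i j. A$i$j + t * (B$i$j - A$i$j))"
    using ST by (auto simp: affine_line_def)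
  have diff: "(S - T)$i$j = (t - s) * (A - B)$i$j" for i j
    by (simp add: s t algebra_simps)
  have minor: "(A - B)$i$j * (A - B)$k$l = (A - B)$i$l * (A - B)$k$j" for i j k l
    using AB rank_eq_1_iff_minors unfolding adjacent_points_def by blast
  have "(S - T)$i$j * (S - T)$k$l = (t - s)^2 * ((A - B)$i$j * (A - B)$k$l)" for i j k l
    unfolding diff by (simp only: power2_eq_square mult_ac)
  then have "(S - T)$i$j * (S - T)$k$l = (S - T)$i$l * (S - T)$k$j" for i j k l
    by (simp only: minor[of i j k l])
  then show ?thesis
    using ST(3) unfolding adjacent_points_def rank_eq_1_iff_minors by simp
qed

lemma affine_line_subset_symmetric_matrices:
  assumes "A \<in> symmetric_matrices" "B \<in> symmetric_matrices"
  shows "affine_line A B \<subseteq> symmetric_matrices"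
  using assms by (auto simp: affine_line_def symmetric_matrices_def transpose_def vec_eq_iff)

lemma mem_affine_line: "A \<in> affine_line A B" "B \<in> affine_line A B"
proof -
  have "A = (\<chi> i j. A$i$j + 0 * (B$i$j - A$i$j))" "B = (\<chi> i j. A$i$j + 1 * (B$i$j - A$i$j))"
    by (simp_all add: vec_eq_iff)
  then show "A \<in> affine_line A B" "B \<in> affine_line A B"
    unfolding affine_line_def by blast+
qed

text \<open>Maximality: adjacency to \<open>A\<close> and \<open>B\<close> alone already forces a
  symmetric matrix onto the affine line.\<close>

lemma affine_line_in_symmetric_lines:
  assumes "A \<in> symmetric_matrices" "B \<in> symmetric_matrices" "adjacent_points A B"
  shows "affine_line A B \<in> symmetric_lines"
proof -
  have "T \<in> affine_line A B"
    if "T \<in> symmetric_matrices" "\<And>S. S \<in> affine_line A B \<Longrightarrow> adjacent_points T S" for T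
    using mem_affine_line_if_adjacent[OF assms(1,2) that(1) assms(3)] that(2) mem_affine_line
    by blast
  then show ?thesis
    unfolding symmetric_lines_def
    using adjacent_points_affine_line[OF assms(3)]
      affine_line_subset_symmetric_matrices[OF assms(1,2)] by (intro CollectI conjI) blast+
qed

lemma symmetric_lineD:
  assumes "M \<in> symmetric_lines" "S \<in> M"
  shows "S \<in> symmetric_matrices" "T \<in> M \<Longrightarrow> S \<noteq> T \<Longrightarrow> adjacent_points S T"
  using assms by (auto simp: symmetric_lines_def)

text \<open>All points of \<open>M\<close> are adjacent or equal to \<open>A\<close> and
  \<open>B\<close>, so they lie on the affine line. A point of that line missing from
  \<open>M\<close> would be adjacent to all of \<open>M\<close>, against maximality.\<close>

lemma symmetric_line_eq_affine_line:
  assumes M: "M \<in> symmetric_lines" and AB: "A \<in> M" "B \<in> M" "A \<noteq> B"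
  shows "M = affine_line A B"
proof
  have sym: "A \<in> symmetric_matrices" "B \<in> symmetric_matrices" and adj: "adjacent_points A B"
    using symmetric_lineD[OF M] AB by blast+
  show sub: "M \<subseteq> affine_line A B"
  proof
    fix C assume "C \<in> M"
    then show "C \<in> affine_line A B"
      using mem_affine_line_if_adjacent[OF sym] adj symmetric_lineD[OF M] AB mem_affine_line
      by metis
  qed
  show "affine_line A B \<subseteq> M"
  proof (rule ccontr)
    assume "\<not> affine_line A B \<subseteq> M"
    then obtain T where T: "T \<in> affine_line A B" "T \<notin> M"
      by blast
    then have "\<forall>S\<in>M. adjacent_points T S"
      using adjacent_points_affine_line[OF adj] sub by blast
    moreover have "T \<in> symmetric_matrices"
      using T affine_line_subset_symmetric_matrices[OF sym] by blast
    ultimately show False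
      using M T(2) by (auto simp: symmetric_lines_def)
  qed
qed

lemma symmetric_line_unique:
  assumes "M \<in> symmetric_lines" "N \<in> symmetric_lines" "A \<noteq> B"
    and "A \<in> M" "B \<in> M" "A \<in> N" "B \<in> N"
  shows "M = N"
  using symmetric_line_eq_affine_line[of M A B] symmetric_line_eq_affine_line[of N A B] assms
  by simp

text \<open>Pairwise adjacency puts \<open>C\<close> on the affine line through \<open>A\<close> and
  \<open>B\<close>, which is \<open>L\<close>; then \<open>L\<close> and \<open>M\<close> share
  \<open>B\<close> and \<open>C\<close>. The conclusion contradicts the distinctness of the lines in
  a 6-cycle.\<close>

lemma symmetric_lines_no_triangle:
  assumes L: "L \<in> symmetric_lines" "M \<in> symmetric_lines" "N \<in> symmetric_lines"
    and P: "A \<in> L" "B \<in> L" "B \<in> M" "C \<in> M" "C \<in> N" "A \<in> N" "A \<noteq> B" "B \<noteq> C" "A \<noteq> C"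
  shows "L = M"
proof -
  have "C \<in> affine_line A B"
  proof (rule mem_affine_line_if_adjacent)
    show "A \<in> symmetric_matrices" "B \<in> symmetric_matrices" "C \<in> symmetric_matrices"
      using symmetric_lineD(1)[OF L(1)] symmetric_lineD(1)[OF L(2)] P by blast+
    show "adjacent_points A B" "adjacent_points C A" "adjacent_points C B"
      using symmetric_lineD(2)[OF L(1)] symmetric_lineD(2)[OF L(2)] symmetric_lineD(2)[OF L(3)] P
      by blast+
  qed
  then have "C \<in> L"
    using symmetric_line_eq_affine_line[OF L(1), of A B] P by blast
  then show ?thesis
    using symmetric_line_unique[OF L(1,2) \<open>B \<noteq> C\<close>] P by blast
qed

section \<open>Short cycles in the incidence graph\<close>

lemma pverts_symmetric_matrix_graph [simp]:
  "pverts symmetric_matrix_graph = symmetric_matrices <+> symmetric_lines"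
  by (simp add: symmetric_matrix_graph_def)

lemma parcs_symmetric_matrix_graph_iff:
  "(Inl S, v) \<in> parcs symmetric_matrix_graph \<longleftrightarrow> (\<exists>M. v = Inr M \<and> M \<in> symmetric_lines \<and> S \<in> M)"
  "(Inr M, v) \<in> parcs symmetric_matrix_graph \<longleftrightarrow> (\<exists>S. v = Inl S \<and> M \<in> symmetric_lines \<and> S \<in> M)"
  using symmetric_lineD(1) by (fastforce simp: symmetric_matrix_graph_def)+

text \<open>Each arc switches between points and lines, so closed walks have even length.\<close>

lemma parity_cas_symmetric_matrix_graph:
  assumes "pcas u p v" "set p \<subseteq> parcs symmetric_matrix_graph"
  shows "even (length p) \<longleftrightarrow> isl u = isl v"
  using assms
proof (induction p arbitrary: u)
  case (Cons e p)
  then have "isl (snd e) \<noteq> isl (fst e)"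
    by (auto simp: symmetric_matrix_graph_def)
  then show ?case
    using Cons by auto
qed auto

lemma symmetric_matrix_graph_cycle_length:
  assumes cyc: "pre_digraph.cycle (with_proj symmetric_matrix_graph) p" and len: "3 \<le> length p"
  shows "8 \<le> length p"
proof (rule ccontr)
  assume "\<not> 8 \<le> length p"
  obtain u where u: "pcas u p u" "set p \<subseteq> parcs symmetric_matrix_graph"
      "distinct (tl (pawalk_verts u p))"
    using cyc unfolding pre_digraph.cycle_def pre_digraph.awalk_def cas_with_proj_eq
      awalk_verts_with_proj_eq by auto
  have "even (length p)"
    using parity_cas_symmetric_matrix_graph[OF u(1,2)] by simp
  with len \<open>\<not> 8 \<le> length p\<close> have "length p = 4 \<or> length p = 6"
    by presburger
  then show False
  proof
    assume "length p = 4"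
    then obtain e1 e2 e3 e4 where p: "p = [e1, e2, e3, e4]"
      by (auto simp: numeral_eq_Suc length_Suc_conv)
    \<comment> \<open>The case split covers cycles rooted at a point and at a line; either way two
      distinct points lie on two distinct lines.\<close>
    show False
      using u unfolding p
      by (cases u; cases e1; cases e2; cases e3; cases e4;
          clarsimp simp: parcs_symmetric_matrix_graph_iff; use symmetric_line_unique in blast)
  next
    assume "length p = 6"
    then obtain e1 e2 e3 e4 e5 e6 where p: "p = [e1, e2, e3, e4, e5, e6]"
      by (auto simp: numeral_eq_Suc length_Suc_conv)
    \<comment> \<open>For both kinds of root, the three points and three lines of the cycle form a
      forbidden triangle.\<close>
    show False
      using u unfolding p
      by (cases u; cases e1; cases e2; cases e3; cases e4; cases e5; cases e6;
          clarsimp simp: parcs_symmetric_matrix_graph_iff; use symmetric_lines_no_triangle in blast)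
  qed
qed

lemma symmetric_matrix_graph_has_cycle_8:
  fixes a b :: "'n::finite"
  assumes ab: "a \<noteq> b"
  obtains p where
    "pre_digraph.cycle
      (with_proj (symmetric_matrix_graph
        :: ('a::field ^ 'n ^ 'n + ('a ^ 'n ^ 'n) set) pair_pre_digraph)) p"
    "length p = 8"
proof -
  define E :: "'n \<Rightarrow> 'a ^ 'n ^ 'n" where "E c = (\<chi> i j. if i = c \<and> j = c then 1 else 0)" for c
  define W where "W = E a + E b"
  have sym: "0 \<in> (symmetric_matrices :: ('a ^ 'n ^ 'n) set)" "E c \<in> symmetric_matrices"
      "W \<in> symmetric_matrices" for c
    by (auto simp: symmetric_matrices_def E_def W_def transpose_def vec_eq_iff)
  have rank_E: "rank (E c) = 1" for c
    unfolding rank_eq_1_iff_minors by (auto simp: E_def vec_eq_iff)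
  have "E a - 0 = E a" "W - E a = E b" "W - E b = E a" "E b - 0 = E b"
    by (simp_all add: W_def)
  then have "adjacent_points (E a) 0" "adjacent_points W (E a)" and adj: "adjacent_points W (E b)"
      "adjacent_points (E b) 0"
    unfolding adjacent_points_def using rank_E by (simp_all only:)
  then have adj': "adjacent_points 0 (E a)" "adjacent_points (E a) W"
    by (blast intro: adjacent_points_sym[THEN iffD1])+
  have minors: "A$a$a * A$b$b = A$a$b * A$b$a" if "rank A = 1" for A :: "'a ^ 'n ^ 'n"
    using that rank_eq_1_iff_minors by blast
  \<comment> \<open>The principal minor on \<open>a\<close>, \<open>b\<close> is 1 for
    \<open>W\<close> and -1 for \<open>E a - E b\<close>, so neither has rank 1.\<close>
  have nadj: "\<not> adjacent_points W 0" "\<not> adjacent_points (E a) (E b)"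
    using ab minors[of W] minors[of "E a - E b"]
    by (auto simp: adjacent_points_def E_def W_def)
  have ne: "0 \<noteq> E a" "0 \<noteq> W" "0 \<noteq> E b" "E a \<noteq> W" "E a \<noteq> E b" "W \<noteq> E b"
    using ab by (auto simp: E_def W_def vec_eq_iff)
  have line: "\<exists>M\<in>symmetric_lines. A \<in> M \<and> B \<in> M"
    if "adjacent_points A B" "A \<in> symmetric_matrices" "B \<in> symmetric_matrices"
    for A B :: "'a ^ 'n ^ 'n"
    using affine_line_in_symmetric_lines[OF that(2,3,1)] mem_affine_line by blast
  obtain L1 where L1: "L1 \<in> symmetric_lines" "0 \<in> L1" "E a \<in> L1"
    using line[OF adj'(1) sym(1,2)] by blast
  obtain L2 where L2: "L2 \<in> symmetric_lines" "E a \<in> L2" "W \<in> L2"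
    using line[OF adj'(2) sym(2,3)] by blast
  obtain L3 where L3: "L3 \<in> symmetric_lines" "W \<in> L3" "E b \<in> L3"
    using line[OF adj(1) sym(3,2)] by blast
  obtain L4 where L4: "L4 \<in> symmetric_lines" "E b \<in> L4" "0 \<in> L4"
    using line[OF adj(2) sym(2,1)] by blast
  have no_diagonal: "\<not> (W \<in> M \<and> 0 \<in> M)" "\<not> (E a \<in> M \<and> E b \<in> M)" if "M \<in> symmetric_lines" for M
    using symmetric_lineD(2)[OF that, of W 0] symmetric_lineD(2)[OF that, of "E a" "E b"] nadj ne
    by metis+
  \<comment> \<open>If two of the sides coincided, that line would contain both ends of a diagonal
    of the quadrangle.\<close>
  have L_ne: "L1 \<noteq> L2" "L1 \<noteq> L3" "L1 \<noteq> L4" "L2 \<noteq> L3" "L2 \<noteq> L4" "L3 \<noteq> L4"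
    using no_diagonal L1 L2 L3 L4 by blast+
  let ?p = "[(Inl 0, Inr L1), (Inr L1, Inl (E a)), (Inl (E a), Inr L2), (Inr L2, Inl W),
    (Inl W, Inr L3), (Inr L3, Inl (E b)), (Inl (E b), Inr L4), (Inr L4, Inl 0)]"
  have "pre_digraph.cycle (with_proj symmetric_matrix_graph) ?p"
    unfolding pre_digraph.cycle_def pre_digraph.awalk_def cas_with_proj_eq awalk_verts_with_proj_eq
    using L1 L2 L3 L4 L_ne ne sym
    by (intro exI[of _ "Inl 0"]) (auto simp: parcs_symmetric_matrix_graph_iff)
  then show thesis
    by (rule that) simp
qed

theorem theorem1:
  fixes q n :: nat
  assumes "primepow q"
    and "CARD('a::{field,finite}) = q"
    and "n \<ge> 2"
    and "CARD('n::finite) = n"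
  shows "girth (symmetric_matrix_graph :: ('a ^ 'n ^ 'n + ('a ^ 'n ^ 'n) set) pair_pre_digraph) = 8"
proof (rule antisym)
  obtain a b :: 'n where "a \<noteq> b"
    using assms(3,4) by (metis UNIV_I card_le_Suc0_iff_eq finite not_less_eq_eq numeral_2_eq_2)
  then obtain p where
    p: "pre_digraph.cycle (with_proj (symmetric_matrix_graph
        :: ('a ^ 'n ^ 'n + ('a ^ 'n ^ 'n) set) pair_pre_digraph)) p" "length p = 8"
    using symmetric_matrix_graph_has_cycle_8 by blast
  have "girth (symmetric_matrix_graph
      :: ('a ^ 'n ^ 'n + ('a ^ 'n ^ 'n) set) pair_pre_digraph) \<le> enat (length p)"
    unfolding girth_def using p by (intro INF_lower) auto
  then show "girth (symmetric_matrix_graph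
      :: ('a ^ 'n ^ 'n + ('a ^ 'n ^ 'n) set) pair_pre_digraph) \<le> 8"
    using p(2) by (simp add: numeral_eq_enat)
  show "8 \<le> girth (symmetric_matrix_graph
      :: ('a ^ 'n ^ 'n + ('a ^ 'n ^ 'n) set) pair_pre_digraph)"
    unfolding girth_def
    by (intro INF_greatest) (auto simp: numeral_eq_enat dest: symmetric_matrix_graph_cycle_length)
qed

end
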